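(* Let $t \geq 3$ be an odd integer. Then $$\mathrm{ex}^*(n, B_{t,3}) = \frac{t}{2}n + O(1).$$
   Context: All graphs are finite and simple. An edge-coloring of a graph is a function $c:E(G)\to\mathbb{N}$; it is proper if incident edges receive different colors. A subgraph is rainbow under $c$ if its edges have pairwise distinct colors. A graph $G$ is rainbow-$F$-free if it admits a proper edge-coloring under which no (not necessarily induced) copy of $F$ in $G$ is rainbow. The rainbow Turán number $\mathrm{ex}^*(n,F)$ is the maximum number of edges in an $n$-vertex rainbow-$F$-free graph. For $t\ge 3$, $B_{t,3}$ is the broom with $t$ edges and handle length $3$: the tree obtained from a path with $3$ edges (the handle) by adding $t-3$ pendant edges (the bristles) at one end vertex of the path. Here $O(1)$ is a quantity bounded by a constant depending only on $t$, as $n\to\infty$. *)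

theory Defs
  imports Complex_Main "HOL-Library.Landau_Symbols"
begin

record 'a graph =
  verts :: "'a set"
  edges :: "'a set set"

definition simple_graph :: "'a graph \<Rightarrow> bool" where
  "simple_graph G \<longleftrightarrow> finite (verts G) \<and> (\<forall>e\<in>edges G. e \<subseteq> verts G \<and> card e = 2)"

definition subgraph :: "'a graph \<Rightarrow> 'a graph \<Rightarrow> bool" where
  "subgraph H G \<longleftrightarrow> simple_graph H \<and> verts H \<subseteq> verts G \<and> edges H \<subseteq> edges G"

definition isomorphic :: "'a graph \<Rightarrow> 'b graph \<Rightarrow> bool" where
  "isomorphic G H \<longleftrightarrow>
     (\<exists>f. bij_betw f (verts G) (verts H) \<and> edges H = (\<lambda>e. f ` e) ` edges G)"

text \<open>An edge-colouring is a total function on vertex sets; only its values on the edges of the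
  graph at hand are ever used.\<close>

definition proper_edge_coloring :: "'a graph \<Rightarrow> ('a set \<Rightarrow> nat) \<Rightarrow> bool" where
  "proper_edge_coloring G c \<longleftrightarrow>
     (\<forall>e\<in>edges G. \<forall>e'\<in>edges G. e \<noteq> e' \<and> e \<inter> e' \<noteq> {} \<longrightarrow> c e \<noteq> c e')"

definition rainbow :: "('a set \<Rightarrow> nat) \<Rightarrow> 'a graph \<Rightarrow> bool" where
  "rainbow c H \<longleftrightarrow> inj_on c (edges H)"

definition rainbow_free :: "'b graph \<Rightarrow> 'a graph \<Rightarrow> bool" where
  "rainbow_free F G \<longleftrightarrow>
     (\<exists>c. proper_edge_coloring G c \<and>
          \<not> (\<exists>H. subgraph H G \<and> isomorphic F H \<and> rainbow c H))"

text \<open>Vertices are natural numbers without loss of generality, as every finite graph is isomorphic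
  to one on natural numbers. The maximum is over a finite set, which is nonempty whenever
  \<open>F\<close> has an edge; see the two lemmas below.\<close>

definition rainbow_turan_set :: "nat \<Rightarrow> 'b graph \<Rightarrow> nat set" where
  "rainbow_turan_set n F =
     {card (edges G) | G :: nat graph. simple_graph G \<and> card (verts G) = n \<and> rainbow_free F G}"

definition rainbow_turan :: "nat \<Rightarrow> 'b graph \<Rightarrow> nat" where
  "rainbow_turan n F = Max (rainbow_turan_set n F)"

lemma finite_rainbow_turan_set: "finite (rainbow_turan_set n F)"
proof (rule finite_subset)
  show "rainbow_turan_set n F \<subseteq> {..2 ^ n}"
  proof
    fix m assume "m \<in> rainbow_turan_set n F"
    then obtain G :: "nat graph"
      where G: "m = card (edges G)" "simple_graph G" "card (verts G) = n"
      by (auto simp: rainbow_turan_set_def)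
    have "edges G \<subseteq> Pow (verts G)" "finite (verts G)"
      using G(2) by (auto simp: simple_graph_def)
    then have "card (edges G) \<le> card (Pow (verts G))"
      by (intro card_mono) auto
    then show "m \<in> {..2 ^ n}"
      using G \<open>finite (verts G)\<close> by (simp add: card_Pow)
  qed
qed simp

lemma rainbow_turan_set_nonempty:
  assumes "edges F \<noteq> {}"
  shows "rainbow_turan_set n F \<noteq> {}"
proof -
  let ?G = "\<lparr>verts = {..<n}, edges = {}\<rparr>"
  have "rainbow_free F ?G"
    using assms
    by (auto simp: rainbow_free_def proper_edge_coloring_def subgraph_def isomorphic_def)
  then have "card (edges ?G) \<in> rainbow_turan_set n F"
    unfolding rainbow_turan_set_def
    by (intro CollectI exI[of _ ?G]) (simp add: simple_graph_def)
  then show ?thesis by blast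
qed

text \<open>The broom with \<open>t\<close> edges and handle length \<open>l \<le> t\<close>: the handle is the path
  \<open>0, 1, \<dots>, l\<close>, and the \<open>t - l\<close> bristles join \<open>l\<close> to the leaves \<open>l + 1, \<dots>, t\<close>.\<close>

definition broom :: "nat \<Rightarrow> nat \<Rightarrow> nat graph" where
  "broom t l = \<lparr>verts = {0..t}, edges = {{i, i + 1} |i. i < l} \<union> {{l, j} |j. l < j \<and> j \<le> t}\<rparr>"

lemma simple_graph_broom:
  assumes "l \<le> t"
  shows "simple_graph (broom t l)"
  using assms by (auto simp: simple_graph_def broom_def)

lemma card_edges_broom:
  assumes "l \<le> t"
  shows "card (edges (broom t l)) = t"
proof -
  have 1: "{{i, i + 1} |i. i < l} = (\<lambda>i. {i, i + 1}) ` {..<l}" (is "?A = _") by auto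
  have 2: "{{l, j} |j. l < j \<and> j \<le> t} = (\<lambda>j. {l, j}) ` {l<..t}" (is "?B = _") by auto
  have "card ?A = l"
    unfolding 1 by (subst card_image) (auto simp: inj_on_def doubleton_eq_iff)
  moreover have "card ?B = t - l"
    unfolding 2 by (subst card_image) (auto simp: inj_on_def doubleton_eq_iff)
  moreover have "?A \<inter> ?B = {}" by (auto simp: doubleton_eq_iff)
  moreover have "finite ?A" "finite ?B" unfolding 1 2 by auto
  ultimately show ?thesis
    using assms by (simp add: broom_def card_Un_disjoint)
qed

end

theory Submission
  imports Defs
begin

text \<open>Lower bound: in a 1-factorised \<open>K\<^bsub>t+1\<^esub>\<close> (\<open>t + 1\<close> is even) a broom is spanning and a rainbow one
  would use all \<open>t\<close> colours; but the colour of the far handle edge also occurs at the centre, on an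
  edge which lies in the broom or meets that handle edge.

  Upper bound: in a minimal counterexample every nonempty vertex set \<open>S\<close> meets more than \<open>t |S| / 2\<close> edges,
  so the minimum degree exceeds \<open>t / 2\<close> and some degree exceeds \<open>t\<close>. A rainbow path of length 3
  from \<open>v\<close> extends to a rainbow broom unless the path and its two far colours block many of the
  edges at \<open>v\<close>. At most 5 can be blocked, so a vertex of degree at least \<open>t + 2\<close> starts no rainbow path
  of length 3; for \<open>t \<ge> 5\<close> this leaves two adjacent vertices of degree at most 3, which meet at most 5
  edges, against minimality (\<open>t = 3\<close> is easy). At a vertex \<open>v\<close> of degree
  \<open>t + 1\<close> exactly 5 are blocked, for every such path. This closes off the component \<open>{v} \<union> N(v)\<close>
  and puts all its colours at \<open>v\<close>. Since \<open>t + 2\<close> is odd, each of the \<open>t + 1\<close> colours misses a vertex,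
  and the edge count forces it to miss exactly one. Any second vertex of degree \<open>t\<close> or \<open>t + 1\<close> then
  yields a path which blocks too few edges.\<close>

section \<open>Neighbourhoods and double counting of degrees\<close>

definition nb :: "'a set set \<Rightarrow> 'a \<Rightarrow> 'a set" where
  "nb E x = {y. {x, y} \<in> E}"

lemma card_nb:
  assumes "\<And>e. e \<in> E \<Longrightarrow> card e = 2"
  shows "card (nb E x) = card {e \<in> E. x \<in> e}"
proof -
  have "bij_betw (\<lambda>y. {x, y}) (nb E x) {e \<in> E. x \<in> e}"
  proof (rule bij_betw_imageI)
    show "inj_on (\<lambda>y. {x, y}) (nb E x)"
      by (auto simp: inj_on_def doubleton_eq_iff)
    show "(\<lambda>y. {x, y}) ` nb E x = {e \<in> E. x \<in> e}"
    proof (intro equalityI subsetI)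
      fix e assume e: "e \<in> {e \<in> E. x \<in> e}"
      with assms have "card e = 2" by auto
      then obtain p q where "e = {p, q}" by (auto simp: card_2_iff)
      with e show "e \<in> (\<lambda>y. {x, y}) ` nb E x"
        by (auto simp: nb_def image_iff insert_commute)
    qed (auto simp: nb_def)
  qed
  then show ?thesis by (rule bij_betw_same_card)
qed

text \<open>Counts incidences: no edge leaves \<open>W\<close>, so every edge meeting
  \<open>W\<close> is counted from both of its ends.\<close>

lemma sum_card_nb:
  assumes "finite W" and "finite E" and "\<And>e. e \<in> E \<Longrightarrow> card e = 2"
    and "\<And>e. e \<in> E \<Longrightarrow> e \<inter> W \<noteq> {} \<Longrightarrow> e \<subseteq> W"
  shows "(\<Sum>x\<in>W. card (nb E x)) = 2 * card {e \<in> E. e \<inter> W \<noteq> {}}"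
proof -
  let ?F = "{e \<in> E. e \<inter> W \<noteq> {}}"
  have "(\<Sum>x\<in>W. card (nb E x)) = (\<Sum>x\<in>W. card {e \<in> ?F. x \<in> e})"
    using assms(3) by (intro sum.cong) (auto simp: card_nb intro!: arg_cong[where f = card])
  also have "\<dots> = 2 * card ?F"
  proof (rule sum_multicount)
    show "\<forall>e\<in>?F. card {x \<in> W. x \<in> e} = 2"
    proof
      fix e assume e: "e \<in> ?F"
      then have "{x \<in> W. x \<in> e} = e" using assms(4) by auto
      with e show "card {x \<in> W. x \<in> e} = 2" using assms(3) by simp
    qed
  qed (use assms in auto)
  finally show ?thesis .
qed

section \<open>Graphs without a rainbow broom\<close>

text \<open>\<open>free\<close> excludes rainbow brooms without subgraphs or isomorphisms:
  \<open>u\<close> is the centre, \<open>u, a, b, w\<close> the handle, \<open>B\<close> the set of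
  bristle leaves. Only colour clashes that properness does not already rule out appear among its
  hypotheses.\<close>

locale broom_free_graph =
  fixes V :: "'a set" and E :: "'a set set" and c :: "'a set \<Rightarrow> nat" and t :: nat
  assumes finite_V: "finite V"
    and edge: "e \<in> E \<Longrightarrow> e \<subseteq> V \<and> card e = 2"
    and proper: "\<lbrakk>{x, y} \<in> E; {x, z} \<in> E; y \<noteq> z\<rbrakk> \<Longrightarrow> c {x, y} \<noteq> c {x, z}"
    and free: "\<lbrakk>{u, a} \<in> E; {a, b} \<in> E; {b, w} \<in> E; u \<noteq> b; a \<noteq> w; u \<noteq> w; c {u, a} \<noteq> c {b, w};
      B \<subseteq> nb E u - {a, b, w}; \<forall>x\<in>B. c {u, x} \<noteq> c {a, b} \<and> c {u, x} \<noteq> c {b, w}\<rbrakk>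
      \<Longrightarrow> card B \<noteq> t - 3"
begin

abbreviation N where "N \<equiv> nb E"
abbreviation deg where "deg x \<equiv> card (N x)"

text \<open>Properness leaves at most one vertex here; the set is empty exactly when the colour
  \<open>k\<close> is missing at \<open>x\<close>.\<close>

definition via :: "'a \<Rightarrow> nat \<Rightarrow> 'a set" where
  "via x k = {y \<in> N x. c {x, y} = k}"

lemma finite_E: "finite E"
  using finite_subset[of E "Pow V"] edge finite_V by auto

lemma N_sub: "N x \<subseteq> V"
  using edge by (fastforce simp: nb_def)

lemma finite_N: "finite (N x)"
  using N_sub finite_V by (rule finite_subset)

lemma not_self: "x \<notin> N x"
  using edge[of "{x}"] by (auto simp: nb_def)

lemma N_sym: "y \<in> N x \<longleftrightarrow> x \<in> N y"
  by (simp add: nb_def insert_commute)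

lemma finite_via: "finite (via x k)"
  using finite_N by (simp add: via_def)

lemma card_via: "card (via x k) \<le> 1"
  unfolding One_nat_def card_le_Suc0_iff_eq[OF finite_via]
  using proper by (auto simp: via_def nb_def)

lemma colour_inj: "inj_on (\<lambda>y. c {x, y}) (N x)"
  using proper by (auto simp: inj_on_def nb_def)

text \<open>The edges at \<open>u\<close> that cannot serve as bristles once the handle is \<open>u, a, b, w\<close>.\<close>

definition blocked :: "'a \<Rightarrow> 'a \<Rightarrow> 'a \<Rightarrow> 'a \<Rightarrow> 'a set" where
  "blocked u a b w = {a, w} \<union> ({b} \<inter> N u) \<union> via u (c {a, b}) \<union> via u (c {b, w})"

definition rpath :: "'a \<Rightarrow> 'a \<Rightarrow> 'a \<Rightarrow> 'a \<Rightarrow> bool" where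
  "rpath u a b w \<longleftrightarrow> a \<in> N u \<and> b \<in> N a \<and> w \<in> N b \<and> u \<noteq> b \<and> a \<noteq> w \<and> u \<noteq> w \<and> c {u, a} \<noteq> c {b, w}"

text \<open>Any \<open>t - 3\<close> unblocked neighbours of \<open>u\<close> would serve as
  bristles and complete a rainbow broom, so at most \<open>t - 4\<close> are unblocked.\<close>

lemma deg_le_blocked:
  assumes "rpath u a b w"
  shows "deg u + 4 \<le> t + card (blocked u a b w)"
proof -
  let ?G = "N u - blocked u a b w"
  have fin: "finite (blocked u a b w)" by (auto simp: blocked_def finite_via)
  have "\<not> t - 3 \<le> card ?G"
  proof
    assume "t - 3 \<le> card ?G"
    then obtain B where B: "B \<subseteq> ?G" "card B = t - 3"
      using obtain_subset_with_card_n by metis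
    have "card B \<noteq> t - 3"
      by (rule free[of u a b w]) (use assms B(1) in \<open>auto simp: rpath_def nb_def blocked_def via_def\<close>)
    with B show False by simp
  qed
  moreover have "deg u \<le> card ?G + card (blocked u a b w)"
    using fin finite_N[of u] by (metis add.commute diff_card_le_card_Diff le_diff_conv)
  ultimately show ?thesis by linarith
qed

lemma card_blocked:
  assumes "a \<noteq> b"
  shows "card (blocked u a b w) \<le> 2 + card ({b} \<inter> N u) + card (via u (c {a, b})) + card (via u (c {b, w}))"
proof -
  have "card {a, w} \<le> 2" by (simp add: card_insert_if)
  then show ?thesis unfolding blocked_def
    by (meson card_Un_le add_mono order_trans order_refl)
qed

lemma card_Int_N: "card ({b} \<inter> N u) \<le> 1"
  by (simp add: card_le_Suc0_iff_eq)

text \<open>The five are \<open>a\<close>, \<open>w\<close>, \<open>b\<close> and one neighbour of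
  \<open>u\<close> for each of the colours of \<open>{a, b}\<close> and
  \<open>{b, w}\<close>.\<close>

lemma card_blocked_le_5:
  assumes "rpath u a b w"
  shows "card (blocked u a b w) \<le> 5"
  using card_blocked[of a b u w] card_Int_N[of b u] card_via[of u "c {a, b}"]
    card_via[of u "c {b, w}"] not_self[of a] assms
  by (force simp: rpath_def)

end

section \<open>Structure of a minimal counterexample\<close>

text \<open>\<open>critical\<close> holds in a minimal counterexample to
  \<open>2 * card E \<le> t * card V\<close>: deleting \<open>S\<close> leaves a graph satisfying
  the bound, so more than \<open>t * card S / 2\<close> edges must be lost.\<close>

locale critical_graph = broom_free_graph +
  assumes critical: "\<lbrakk>S \<subseteq> V; S \<noteq> {}\<rbrakk> \<Longrightarrow> t * card S < 2 * card {e \<in> E. e \<inter> S \<noteq> {}}"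
    and t3: "t \<ge> 3" and odd_t: "odd t" and V_nonempty: "V \<noteq> {}"
begin

lemma card_N: "deg x = card {e \<in> E. x \<in> e}"
  using edge by (simp add: card_nb)

lemma deg_gt: "x \<in> V \<Longrightarrow> t < 2 * deg x"
  using critical[of "{x}"] by (simp add: card_N)

text \<open>Averaging: criticality of \<open>V\<close> itself makes the mean degree exceed
  \<open>t\<close>.\<close>

lemma ex_large_deg:
  obtains v where "v \<in> V" "t < deg v"
proof -
  have "(\<Sum>x\<in>V. deg x) = 2 * card {e \<in> E. e \<inter> V \<noteq> {}}"
    using edge by (intro sum_card_nb finite_V finite_E) auto
  with critical[of V] have "t * card V < (\<Sum>x\<in>V. deg x)"
    using V_nonempty by simp
  then have "\<not> (\<forall>x\<in>V. deg x \<le> t)"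
    using sum_bounded_above[of V deg t] by (auto simp: mult.commute)
  then show thesis using that by force
qed

lemma ex_neighbour:
  assumes "finite F" "card F < deg x"
  obtains y where "y \<in> N x" "y \<notin> F"
  using assms card_mono[of F "N x"] by (meson not_le subsetI)

lemma t_neq_3: "t \<noteq> 3"
proof
  assume t: "t = 3"
  obtain v where v: "v \<in> V" "t < deg v" by (rule ex_large_deg)
  obtain a where a: "a \<in> N v" by (rule ex_neighbour[of "{}" v]) (use v in auto)
  have "a \<in> V" using a N_sub by blast
  then have "2 \<le> deg a" using deg_gt[of a] t by simp
  then obtain b where b: "b \<in> N a" "b \<noteq> v" by (rule_tac ex_neighbour[of "{v}" a]) auto
  \<comment> \<open>The end \<open>w\<close> must avoid \<open>a\<close>, \<open>b\<close> and the
    neighbour of \<open>v\<close> that repeats the colour of \<open>{a, b}\<close>; degree at least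
    4 leaves a choice.\<close>
  have "card ({a, b} \<union> via v (c {a, b})) \<le> 3"
    using card_via[of v "c {a, b}"] card_Un_le[of "{a, b}" "via v (c {a, b})"]
    by (simp add: card_insert_if split: if_splits)
  then obtain w where w: "w \<in> N v" "w \<notin> {a, b} \<union> via v (c {a, b})"
    by (rule_tac ex_neighbour[of "{a, b} \<union> via v (c {a, b})" v]) (use v t finite_via in auto)
  \<comment> \<open>For \<open>t = 3\<close> the broom is the path \<open>b, a, v, w\<close> itself,
    with no bristles.\<close>
  have "card ({} :: 'a set) \<noteq> t - 3"
    by (rule free[of b a v w]) (use a b w in \<open>auto simp: nb_def via_def insert_commute\<close>)
  with t show False by simp
qed

lemma t5: "t \<ge> 5"
  using t3 t_neq_3 odd_t by (cases "t = 4") auto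

lemma deg_ge_3: "x \<in> V \<Longrightarrow> 3 \<le> deg x"
  using deg_gt[of x] t5 by linarith

text \<open>Degree at least \<open>t + 2\<close> would need six blocked vertices, so no
  \<open>rpath\<close> starts at \<open>v\<close>; two adjacent vertices of small degree then
  contradict criticality.\<close>

lemma deg_le: "v \<in> V \<Longrightarrow> deg v \<le> t + 1"
proof (rule ccontr)
  assume v: "v \<in> V" and "\<not> deg v \<le> t + 1"
  then have no: "\<not> rpath v a b w" for a b w
    using deg_le_blocked[of v a b w] card_blocked_le_5[of v a b w] by auto
  \<comment> \<open>As no such path exists, every \<open>w\<close> in \<open>N b\<close> other than
    \<open>v\<close> and \<open>a\<close> has \<open>c {b, w} = c {v, a}\<close>. This leaves at
    most three neighbours, and at most two if \<open>b\<close> is not adjacent to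
    \<open>v\<close>.\<close>
  have step: "deg b \<le> 3 \<and> b \<in> N v" if a: "a \<in> N v" and b: "b \<in> N a" "b \<noteq> v" for a b
  proof -
    let ?M = "{a} \<union> via b (c {v, a})"
    have sub: "N b \<subseteq> insert v ?M"
    proof
      fix w assume "w \<in> N b"
      then show "w \<in> insert v ?M"
        using no[of a b w] a b by (auto simp: rpath_def via_def)
    qed
    have M: "card ?M \<le> 2" "finite ?M"
      using card_Un_le[of "{a}" "via b (c {v, a})"] card_via[of b "c {v, a}"] by (auto simp: finite_via)
    have "card (insert v ?M) \<le> 3"
      using M by (metis Suc_le_mono card_insert_le_m1 card_insert_if le_SucI numeral_3_eq_3 numeral_2_eq_2)
    then have "deg b \<le> 3" using card_mono[OF _ sub] M by auto
    moreover have "b \<in> N v"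
    proof (rule ccontr)
      assume "b \<notin> N v"
      then have "N b \<subseteq> ?M" using sub N_sym[of v b] by auto
      then have "deg b \<le> 2" using M card_mono[of ?M "N b"] by linarith
      moreover have "b \<in> V" using b N_sub by blast
      ultimately show False using deg_ge_3[of b] by simp
    qed
    ultimately show ?thesis ..
  qed
  obtain a where a: "a \<in> N v" by (rule ex_neighbour[of "{}" v]) (use v deg_ge_3[of v] in auto)
  have "a \<in> V" using a N_sub by blast
  then have "2 \<le> deg a" using deg_ge_3[of a] by simp
  then obtain b where b: "b \<in> N a" "b \<noteq> v" by (rule_tac ex_neighbour[of "{v}" a]) auto
  have b3: "deg b \<le> 3" "b \<in> N v" using step[OF a b] by auto
  have "deg a \<le> 3" using step[of b a] b3 a b not_self[of v] N_sym[of a b] by metis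
  \<comment> \<open>The edge \<open>{a, b}\<close> counts towards both degrees, so at most 3 + 3 - 1
    = 5 edges meet \<open>{a, b}\<close>.\<close>
  have "{e \<in> E. e \<inter> {a, b} \<noteq> {}} = {e \<in> E. a \<in> e} \<union> {e \<in> E. b \<in> e}" by auto
  moreover have "card ({e \<in> E. a \<in> e} \<union> {e \<in> E. b \<in> e}) + card ({e \<in> E. a \<in> e} \<inter> {e \<in> E. b \<in> e})
      = deg a + deg b"
    using finite_E card_Un_Int[of "{e \<in> E. a \<in> e}" "{e \<in> E. b \<in> e}"] by (simp add: card_N)
  moreover have "{a, b} \<in> {e \<in> E. a \<in> e} \<inter> {e \<in> E. b \<in> e}"
    using b by (auto simp: nb_def)
  then have "1 \<le> card ({e \<in> E. a \<in> e} \<inter> {e \<in> E. b \<in> e})"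
    using finite_E by (metis (no_types, lifting) One_nat_def Suc_leI card_gt_0_iff empty_iff finite_Int finite_subset mem_Collect_eq subsetI)
  moreover have "{a, b} \<subseteq> V" "card {a, b} = 2"
    using a b not_self[of a] N_sub by (auto simp: card_insert_if)
  ultimately have "t * 2 < 2 * 5"
    using critical[of "{a, b}"] \<open>deg a \<le> 3\<close> b3 by auto
  then show False using t5 by simp
qed

text \<open>At degree \<open>t + 1\<close> every \<open>rpath\<close> must block five vertices; if
  \<open>b\<close> were not adjacent to \<open>v\<close>, it would block nothing and only four would
  remain.\<close>

lemma neighbourhood_closed:
  assumes v: "deg v = t + 1" and a: "a \<in> N v" and b: "b \<in> N a" "b \<noteq> v"
  shows "b \<in> N v"
proof (rule ccontr)
  assume nb: "b \<notin> N v"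
  have "b \<in> V" using b N_sub by blast
  have "card ({a} \<union> via b (c {v, a})) \<le> 2"
    using card_Un_le[of "{a}" "via b (c {v, a})"] card_via[of b "c {v, a}"] by simp
  then obtain w where w: "w \<in> N b" "w \<notin> {a} \<union> via b (c {v, a})"
    by (rule_tac ex_neighbour[of "{a} \<union> via b (c {v, a})" b])
      (use deg_ge_3[OF \<open>b \<in> V\<close>] finite_via in auto)
  then have p: "rpath v a b w"
    using a b nb N_sym[of v b] by (auto simp: rpath_def via_def)
  have "card (blocked v a b w) \<le> 4"
    using card_blocked[of a b v w] nb card_via[of v "c {a, b}"] card_via[of v "c {b, w}"]
      b not_self[of a] by force
  with deg_le_blocked[OF p] v show False by simp
qed

text \<open>The same count again: if the colour of \<open>{b, w}\<close> were missing at
  \<open>v\<close>, it would block nothing.\<close>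

lemma colours_closed:
  assumes v: "deg v = t + 1" and b: "b \<in> N v" and w: "w \<in> N v" "w \<in> N b"
  shows "c {b, w} \<in> (\<lambda>y. c {v, y}) ` N v"
proof (rule ccontr)
  assume no: "c {b, w} \<notin> (\<lambda>y. c {v, y}) ` N v"
  have "b \<in> V" using b N_sub by blast
  then have "card {v, w} < deg b"
    using deg_ge_3[of b] by (simp add: card_insert_if split: if_splits)
  then obtain a where a: "a \<in> N b" "a \<notin> {v, w}"
    by (rule_tac ex_neighbour[of "{v, w}" b]) auto
  have "a \<in> N v" using neighbourhood_closed[OF v b] a by auto
  have p: "rpath v a b w"
    using a b w no \<open>a \<in> N v\<close> not_self[of v] N_sym[of a b] by (auto simp: rpath_def image_iff)
  have "via v (c {b, w}) = {}" using no by (force simp: via_def)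
  then have "card (blocked v a b w) \<le> 4"
    using card_blocked[of a b v w] card_via[of v "c {a, b}"] card_Int_N[of b v]
      a not_self[of b] by force
  with deg_le_blocked[OF p] v show False by simp
qed

section \<open>Parity of colour classes and the final contradiction\<close>

text \<open>By properness the edges of colour \<open>k\<close> inside \<open>W\<close> form a
  matching, and the vertices that see \<open>k\<close> are exactly those it covers.\<close>

lemma even_card_via: "even (card {x \<in> W. via x k \<noteq> {}})" if "\<And>x. x \<in> W \<Longrightarrow> N x \<subseteq> W" and "W \<subseteq> V"
proof -
  let ?M = "{e \<in> E. e \<subseteq> W \<and> c e = k}"
  have "{x \<in> W. via x k \<noteq> {}} = \<Union> ?M"
  proof (intro equalityI subsetI)
    fix x assume "x \<in> {x \<in> W. via x k \<noteq> {}}"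
    then obtain y where "x \<in> W" "y \<in> N x" "c {x, y} = k" by (auto simp: via_def)
    then have "{x, y} \<in> ?M" using that(1)[of x] by (auto simp: nb_def)
    then show "x \<in> \<Union> ?M" by blast
  next
    fix x assume "x \<in> \<Union> ?M"
    then obtain e where e: "e \<in> E" "e \<subseteq> W" "c e = k" "x \<in> e" by auto
    then obtain y where "e = {x, y}"
      using edge[of e] by (auto simp: card_2_iff)
    with e show "x \<in> {x \<in> W. via x k \<noteq> {}}" by (auto simp: via_def nb_def)
  qed
  moreover have "2 dvd card (\<Union> ?M)"
  proof (rule dvd_partition)
    show "finite (\<Union> ?M)"
      using that(2) finite_V by (auto intro: finite_subset[of _ V])
    show "\<forall>e\<in>?M. 2 dvd card e" using edge by auto
    show "\<forall>e\<in>?M. \<forall>e'\<in>?M. e \<noteq> e' \<longrightarrow> e \<inter> e' = {}"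
    proof (intro ballI impI, rule ccontr)
      fix e e' assume e: "e \<in> ?M" "e' \<in> ?M" "e \<noteq> e'" "e \<inter> e' \<noteq> {}"
      then obtain x where x: "x \<in> e" "x \<in> e'" by auto
      obtain y where "e = {x, y}" using e x edge[of e] by (auto simp: card_2_iff)
      moreover obtain z where "e' = {x, z}" using e x edge[of e'] by (auto simp: card_2_iff)
      ultimately show False using e proper[of x y z] by auto
    qed
  qed
  ultimately show ?thesis by simp
qed

lemma no_critical_graph: False
proof -
  obtain v where v: "v \<in> V" "t < deg v" by (rule ex_large_deg)
  then have deg_v: "deg v = t + 1" using deg_le[of v] by simp
  define W where "W = insert v (N v)"
  define C where "C = (\<lambda>y. c {v, y}) ` N v"
  have WV: "W \<subseteq> V" and fin_W: "finite W" and card_W: "card W = t + 2"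
    using v N_sub finite_N[of v] not_self[of v] deg_v by (auto simp: W_def)
  have card_C: "card C = t + 1" and fin_C: "finite C"
    using colour_inj[of v] deg_v finite_N by (auto simp: C_def card_image)
  have closed: "N x \<subseteq> W" if "x \<in> W" for x
    using that neighbourhood_closed[OF deg_v] by (auto simp: W_def)
  have colour: "c {x, y} \<in> C" if xy: "x \<in> W" "y \<in> N x" for x y
  proof -
    have "y \<in> W" using closed that by blast
    consider "x = v" | "y = v" | "x \<in> N v" "y \<in> N v" using \<open>y \<in> W\<close> xy by (auto simp: W_def)
    then show ?thesis
    proof cases
      case 2
      then have "x \<in> N v" using that N_sym[of y x] by simp
      with 2 show ?thesis by (auto simp: C_def insert_commute)
    qed (use that colours_closed[OF deg_v] in \<open>auto simp: C_def\<close>)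
  qed
  have inner: "e \<subseteq> W" if e: "e \<in> E" "e \<inter> W \<noteq> {}" for e
  proof -
    obtain x where x: "x \<in> e" "x \<in> W" using e by auto
    then obtain y where "e = {x, y}" using e edge[of e] by (auto simp: card_2_iff)
    then show ?thesis using e x closed[of x] by (auto simp: nb_def)
  qed
  have deg_sum: "t * (t + 2) < (\<Sum>x\<in>W. deg x)"
    using critical[of W] WV card_W sum_card_nb[OF fin_W finite_E] edge inner
    by (auto simp: W_def)
  have deg_colours: "deg x = card {k \<in> C. via x k \<noteq> {}}" if "x \<in> W" for x
  proof -
    have "{k \<in> C. via x k \<noteq> {}} = (\<lambda>y. c {x, y}) ` N x"
      using colour[OF that] by (auto simp: via_def)
    then show ?thesis using colour_inj[of x] by (simp add: card_image)
  qed
  have even_seen: "even (card {x \<in> W. via x k \<noteq> {}})" for k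
    using even_card_via closed WV by blast
  \<comment> \<open>\<open>W\<close> has the odd number \<open>t + 2\<close> of vertices, so by
    parity no colour is seen by all of them.\<close>
  have seen_le: "card {x \<in> W. via x k \<noteq> {}} \<le> t + 1" for k
  proof -
    have "card {x \<in> W. via x k \<noteq> {}} \<le> t + 2"
      using card_mono[OF fin_W, of "{x \<in> W. via x k \<noteq> {}}"] card_W by auto
    moreover have "card {x \<in> W. via x k \<noteq> {}} \<noteq> t + 2"
      using even_seen[of k] odd_t by (metis even_add even_numeral)
    ultimately show ?thesis by linarith
  qed
  \<comment> \<open>Double counting of the pairs of a vertex and a colour seen there.\<close>
  have sum_seen: "(\<Sum>x\<in>W. deg x) = (\<Sum>k\<in>C. card {x \<in> W. via x k \<noteq> {}})"
    using sum_multicount_gen[OF fin_W fin_C, of "\<lambda>x k. via x k \<noteq> {}"] deg_colours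
    by auto
  \<comment> \<open>A single colour seen at most \<open>t\<close> times would bring the sum down to
    \<open>t + t * (t + 1) = t * (t + 2)\<close>, which \<open>deg_sum\<close> forbids.\<close>
  have seen: "card {x \<in> W. via x k \<noteq> {}} = t + 1" if k: "k \<in> C" for k
  proof (rule ccontr)
    assume "card {x \<in> W. via x k \<noteq> {}} \<noteq> t + 1"
    then have "card {x \<in> W. via x k \<noteq> {}} \<le> t" using seen_le[of k] by simp
    moreover have "(\<Sum>k\<in>C - {k}. card {x \<in> W. via x k \<noteq> {}}) \<le> t * (t + 1)"
      using sum_bounded_above[of "C - {k}" "\<lambda>k. card {x \<in> W. via x k \<noteq> {}}" "t + 1"] seen_le
        k fin_C card_C by simp
    moreover have "(\<Sum>k\<in>C. card {x \<in> W. via x k \<noteq> {}})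
        = card {x \<in> W. via x k \<noteq> {}} + (\<Sum>k\<in>C - {k}. card {x \<in> W. via x k \<noteq> {}})"
      using k fin_C by (rule sum.remove[rotated])
    ultimately have "(\<Sum>x\<in>W. deg x) \<le> t + t * (t + 1)" using sum_seen by linarith
    with deg_sum show False by (simp add: algebra_simps)
  qed
  have missing: "\<exists>m. {x \<in> W. via x k = {}} = {m}" if k: "k \<in> C" for k
  proof -
    have "{x \<in> W. via x k = {}} = W - {x \<in> W. via x k \<noteq> {}}" by auto
    then have "card {x \<in> W. via x k = {}} = 1"
      using seen[OF k] card_W fin_W by (simp add: card_Diff_subset)
    then show ?thesis by (auto simp: card_1_singleton_iff)
  qed
  \<comment> \<open>Otherwise the degrees sum to at most
    \<open>(t + 1) + (t + 1) * (t - 1) = t * (t + 1)\<close>, too little for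
    \<open>deg_sum\<close>.\<close>
  have "\<exists>u\<in>W - {v}. t \<le> deg u"
  proof (rule ccontr)
    assume "\<not> (\<exists>u\<in>W - {v}. t \<le> deg u)"
    then have "\<And>x. x \<in> W - {v} \<Longrightarrow> deg x \<le> t - 1" by force
    moreover have "card (W - {v}) = t + 1"
      using deg_v not_self[of v] by (simp add: W_def)
    ultimately have "(\<Sum>x\<in>W - {v}. deg x) \<le> (t + 1) * (t - 1)"
      using sum_bounded_above[of "W - {v}" deg "t - 1"] by simp
    moreover have "(\<Sum>x\<in>W. deg x) = t + 1 + (\<Sum>x\<in>W - {v}. deg x)"
      using sum.remove[OF fin_W, of v deg] deg_v by (simp add: W_def)
    ultimately show False using deg_sum t5 by (cases t) auto
  qed
  then obtain u where u: "u \<in> W" "u \<noteq> v" "t \<le> deg u" by auto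
  then have "u \<in> V" using WV by auto
  then have "deg u = t \<or> deg u = t + 1" using deg_le[of u] u by linarith
  then show False
  proof
    \<comment> \<open>\<open>u\<close> has one non-neighbour \<open>u'\<close> in \<open>W\<close>
      and misses a colour \<open>k\<close>, which \<open>u'\<close> then sees on some edge
      \<open>{a, u'}\<close>. On a path \<open>u, a, u', w\<close> neither \<open>u'\<close> nor
      \<open>k\<close> blocks anything at \<open>u\<close>, so at most 3 vertices are blocked where
      4 are needed.\<close>
    assume deg_u: "deg u = t"
    have "card (W - insert u (N u)) = 1"
      using card_W deg_u finite_N[of u] not_self[of u] closed[of u] u
      by (simp add: card_Diff_subset)
    then obtain u' where u': "W - insert u (N u) = {u'}" by (auto simp: card_1_singleton_iff)
    then have u'_W: "u' \<in> W" and u'_ne: "u' \<noteq> u" and u'_nb: "u' \<notin> N u" by auto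
    have "\<exists>k\<in>C. via u k = {}"
    proof (rule ccontr)
      assume "\<not> ?thesis"
      then have "{k \<in> C. via u k \<noteq> {}} = C" by auto
      then show False using deg_colours[OF u(1)] card_C deg_u by simp
    qed
    then obtain k where k: "k \<in> C" "via u k = {}" by auto
    obtain m where m: "{x \<in> W. via x k = {}} = {m}" using missing[OF k(1)] by blast
    have "u \<in> {x \<in> W. via x k = {}}" using u k by simp
    then have "u = m" unfolding m by simp
    moreover have "u' \<notin> {x \<in> W. via x k = {}}" if "u' \<noteq> m" using that unfolding m by simp
    ultimately have "via u' k \<noteq> {}" using u'_W u'_ne by auto
    then obtain a where a: "a \<in> N u'" "c {u', a} = k" by (auto simp: via_def)
    then have a_u: "a \<noteq> u" "a \<noteq> u'" using u'_nb N_sym[of a u'] not_self by auto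
    have "a \<in> W" using a closed[OF u'_W] by auto
    then have a_N: "a \<in> N u" using u' a_u by blast
    have "card ({a} \<union> via u' (c {u, a})) \<le> 2"
      using card_Un_le[of "{a}" "via u' (c {u, a})"] card_via[of u' "c {u, a}"] by simp
    moreover have "3 \<le> deg u'" using deg_ge_3[of u'] u'_W WV by auto
    ultimately obtain w where w: "w \<in> N u'" "w \<notin> {a} \<union> via u' (c {u, a})"
      by (rule_tac ex_neighbour[of "{a} \<union> via u' (c {u, a})" u']) (use finite_via in auto)
    have p: "rpath u a u' w"
      using a w a_N u'_ne u'_nb N_sym[of a u'] N_sym[of u u'] by (auto simp: rpath_def via_def)
    have "via u (c {a, u'}) = {}" using k a by (simp add: insert_commute)
    then have "card (blocked u a u' w) \<le> 3"
      using card_blocked[of a u' u w] card_via[of u "c {u', w}"] u'_nb a_u by auto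
    with deg_le_blocked[OF p] deg_u show False by simp
  next
    \<comment> \<open>The aim is a path \<open>v, b, y, u\<close> whose middle edge has the colour
      of \<open>{v, u}\<close>. That colour blocks only \<open>u\<close>, which is blocked already
      as the end of the path, so at most 4 vertices are blocked where 5 are needed.\<close>
    assume deg_u: "deg u = t + 1"
    have "{k \<in> C. via u k \<noteq> {}} = C"
      using deg_colours[OF u(1)] deg_u card_C fin_C by (intro card_subset_eq) auto
    then have full_u: "via u k \<noteq> {}" if "k \<in> C" for k using that by auto
    have full_v: "via v k \<noteq> {}" if "k \<in> C" for k using that by (auto simp: C_def via_def)
    have u_N: "u \<in> N v" using u by (auto simp: W_def)
    define k where "k = c {v, u}"
    have k: "k \<in> C" using u_N by (auto simp: C_def k_def)
    then obtain m where m: "{x \<in> W. via x k = {}} = {m}" using missing by blast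
    have "m \<in> {x \<in> W. via x k = {}}" unfolding m by simp
    then have m': "m \<in> W" "m \<noteq> v" "m \<noteq> u" "via m k = {}"
      using full_u[OF k] full_v[OF k] by auto
    then have m_N: "m \<in> N v" by (auto simp: W_def)
    \<comment> \<open>The colour \<open>j\<close> will be that of \<open>{y, u}\<close>. Then
      \<open>c {v, b} = j\<close> would force \<open>b = m\<close>, impossible since
      \<open>b\<close> lies on an edge of colour \<open>k\<close> and \<open>m\<close> misses
      \<open>k\<close>; so the path is rainbow.\<close>
    define j where "j = c {v, m}"
    have j: "j \<in> C" using m_N by (auto simp: C_def j_def)
    then obtain y where y: "y \<in> N u" "c {u, y} = j" using full_u by (auto simp: via_def)
    have "j \<noteq> k" using colour_inj[of v] m_N u_N m' by (auto simp: inj_on_def j_def k_def)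
    have y_v: "y \<noteq> v" using y \<open>j \<noteq> k\<close> by (auto simp: k_def insert_commute)
    have y_m: "y \<noteq> m"
      using y m_N m' proper[of m u v] u by (auto simp: j_def nb_def insert_commute)
    have y_W: "y \<in> W" using y closed u by auto
    have "via y k \<noteq> {}"
    proof -
      have "y \<notin> {x \<in> W. via x k = {}}" unfolding m using y_m by simp
      with y_W show ?thesis by simp
    qed
    then obtain b where b: "b \<in> N y" "c {y, b} = k" by (auto simp: via_def)
    have y_u: "y \<noteq> u" using y not_self by auto
    have b_v: "b \<noteq> v"
      using b y_u u_N proper[of v y u] by (auto simp: k_def nb_def insert_commute)
    have b_u: "b \<noteq> u"
      using b y_v u_N proper[of u y v] by (auto simp: k_def nb_def insert_commute)
    have b_W: "b \<in> W" using b closed[OF y_W] by auto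
    have b_N: "b \<in> N v" using b_W b_v by (auto simp: W_def)
    have "b \<noteq> m"
    proof
      assume "b = m"
      then have "y \<in> via m k" using b N_sym[of b y] by (auto simp: via_def insert_commute)
      with m' show False by simp
    qed
    then have "c {v, b} \<noteq> j"
      using colour_inj[of v] m_N b_N by (auto simp: inj_on_def j_def)
    moreover have "c {y, u} = j" using y by (simp add: insert_commute)
    moreover have "y \<in> N b" "u \<in> N y" using b(1) y(1) N_sym[of y b] N_sym[of u y] by simp_all
    ultimately have p: "rpath v b y u"
      using b_N b_u y_v u by (simp add: rpath_def)
    have "c {b, y} = k" using b by (simp add: insert_commute)
    moreover have "via v k = {u}"
    proof
      show "{u} \<subseteq> via v k" using u_N by (simp add: via_def k_def)
      show "via v k \<subseteq> {u}"
        using u_N inj_onD[OF colour_inj[of v], of _ u] by (auto simp: via_def k_def)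
    qed
    ultimately have "via v (c {b, y}) = {u}" by simp
    then have "blocked v b y u = {b, u} \<union> ({y} \<inter> N v) \<union> via v (c {y, u})"
      by (auto simp: blocked_def)
    moreover have "card {b, u} \<le> 2" by (simp add: card_insert_if)
    ultimately have "card (blocked v b y u) \<le> 4"
      using card_Un_le[of "{b, u} \<union> ({y} \<inter> N v)" "via v (c {y, u})"]
        card_Un_le[of "{b, u}" "{y} \<inter> N v"] card_Int_N[of y v] card_via[of v "c {y, u}"] by simp
    with deg_le_blocked[OF p] deg_v show False by simp
  qed
qed

end

section \<open>The edge bound by induction on the number of vertices\<close>

lemma broom_free_graph_subset:
  assumes "broom_free_graph V E c t" and "E' \<subseteq> E" and "V' \<subseteq> V" and "\<And>e. e \<in> E' \<Longrightarrow> e \<subseteq> V'"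
  shows "broom_free_graph V' E' c t"
proof -
  interpret G: broom_free_graph V E c t by (rule assms(1))
  show ?thesis
  proof
    show "finite V'" using assms(3) G.finite_V by (rule finite_subset)
    show "e \<subseteq> V' \<and> card e = 2" if "e \<in> E'" for e
      using assms(2,4) that G.edge by auto
    show "c {x, y} \<noteq> c {x, z}" if "{x, y} \<in> E'" "{x, z} \<in> E'" "y \<noteq> z" for x y z
      using assms(2) that G.proper[of x y z] by auto
    fix u a b w B
    assume *: "{u, a} \<in> E'" "{a, b} \<in> E'" "{b, w} \<in> E'" "u \<noteq> b" "a \<noteq> w" "u \<noteq> w"
      "c {u, a} \<noteq> c {b, w}" "B \<subseteq> nb E' u - {a, b, w}"
      "\<forall>x\<in>B. c {u, x} \<noteq> c {a, b} \<and> c {u, x} \<noteq> c {b, w}"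
    show "card B \<noteq> t - 3"
    proof (rule G.free[of u a b w])
      show "B \<subseteq> nb E u - {a, b, w}" using *(8) assms(2) by (auto simp: nb_def)
    qed (use * assms(2) in auto)
  qed
qed

text \<open>If the bound fails but holds for all smaller vertex sets, the graph is a
  \<open>critical_graph\<close>, which \<open>no_critical_graph\<close> excludes.\<close>

lemma card_edges_le:
  assumes "broom_free_graph V E c t" and "t \<ge> 3" and "odd t"
  shows "2 * card E \<le> t * card V"
  using assms(1)
proof (induction "card V" arbitrary: V E rule: less_induct)
  case less
  interpret G: broom_free_graph V E c t by (rule less.prems)
  show ?case
  proof (rule ccontr)
    assume big: "\<not> 2 * card E \<le> t * card V"
    have crit: "t * card S < 2 * card {e \<in> E. e \<inter> S \<noteq> {}}" if S: "S \<subseteq> V" "S \<noteq> {}" for S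
    proof -
      let ?E = "{e \<in> E. e \<inter> S = {}}"
      have "broom_free_graph (V - S) ?E c t"
        by (rule broom_free_graph_subset[OF less.prems]) (use G.edge in auto)
      moreover have "card (V - S) < card V"
        using S G.finite_V by (intro psubset_card_mono) auto
      ultimately have "2 * card ?E \<le> t * card (V - S)"
        by (rule less.hyps[rotated])
      moreover have "card E = card ?E + card {e \<in> E. e \<inter> S \<noteq> {}}"
      proof -
        have "E = ?E \<union> {e \<in> E. e \<inter> S \<noteq> {}}" by blast
        moreover have "card (?E \<union> {e \<in> E. e \<inter> S \<noteq> {}}) = card ?E + card {e \<in> E. e \<inter> S \<noteq> {}}"
          using G.finite_E by (intro card_Un_disjoint) auto
        ultimately show ?thesis by simp
      qed
      moreover have "card V = card (V - S) + card S"
        using S G.finite_V card_mono[of V S] by (simp add: card_Diff_subset finite_subset)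
      then have "t * card V = t * card (V - S) + t * card S" by (simp add: algebra_simps)
      ultimately show ?thesis using big by linarith
    qed
    have "V \<noteq> {}"
    proof
      assume "V = {}"
      then have "E = {}" using G.edge by fastforce
      with big show False by simp
    qed
    then have "critical_graph V E c t"
      using crit assms(2,3) by unfold_locales
    then show False by (rule critical_graph.no_critical_graph)
  qed
qed

section \<open>From local configurations to copies of the broom\<close>

lemma inj_on_UnI: "inj_on f A \<Longrightarrow> inj_on f B \<Longrightarrow> f ` A \<inter> f ` B = {} \<Longrightarrow> inj_on f (A \<union> B)"
  unfolding inj_on_Un by blast

lemma edges_broom3:
  assumes "t \<ge> 3"
  shows "edges (broom t 3) = {{0, 1}, {1, 2}, {2, 3}} \<union> (\<lambda>j. {3, j}) ` {4..t}"
proof -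
  have "{{i, i + 1} |i. i < 3} = (\<lambda>i::nat. {i, i + 1}) ` {..<3}" by auto
  also have "{..<3} = {0, 1, 2::nat}" by auto
  finally have "{{i, i + 1} |i. i < 3} = {{0, 1}, {1, 2}, {2, 3::nat}}" by (simp add: numeral_eq_Suc)
  moreover have "{{3, j} |j. 3 < j \<and> j \<le> t} = (\<lambda>j. {3, j}) ` {4..t}" by (auto simp: image_def)
  ultimately show ?thesis by (simp only: broom_def graph.simps)
qed

text \<open>Links the isomorphism-based definition to the locale: a configuration violating
  \<open>free\<close> is turned into an explicit rainbow copy \<open>H\<close>.\<close>

lemma broom_free_graph_of_coloring:
  fixes G :: "'a graph"
  assumes t: "t \<ge> 3" and G: "simple_graph G" and c: "proper_edge_coloring G c"
    and free: "\<not> (\<exists>H. subgraph H G \<and> isomorphic (broom t 3) H \<and> rainbow c H)"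
  shows "broom_free_graph (verts G) (edges G) c t"
proof
  show "finite (verts G)" using G by (simp add: simple_graph_def)
  show "e \<subseteq> verts G \<and> card e = 2" if "e \<in> edges G" for e
    using G that by (auto simp: simple_graph_def)
  show proper: "c {x, y} \<noteq> c {x, z}" if "{x, y} \<in> edges G" "{x, z} \<in> edges G" "y \<noteq> z" for x y z
    using c that by (auto simp: proper_edge_coloring_def doubleton_eq_iff)
  fix u a b w B
  assume e: "{u, a} \<in> edges G" "{a, b} \<in> edges G" "{b, w} \<in> edges G"
    and ne: "u \<noteq> b" "a \<noteq> w" "u \<noteq> w" and col: "c {u, a} \<noteq> c {b, w}"
    and B: "B \<subseteq> nb (edges G) u - {a, b, w}"
    and colB: "\<forall>x\<in>B. c {u, x} \<noteq> c {a, b} \<and> c {u, x} \<noteq> c {b, w}"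
  have sing: "{x} \<notin> edges G" for x using G by (auto simp: simple_graph_def)
  have ne2: "u \<noteq> a" "a \<noteq> b" "b \<noteq> w" "u \<notin> B"
    using e B sing by (auto simp: nb_def)
  show "card B \<noteq> t - 3"
  proof
    assume cardB: "card B = t - 3"
    have "B \<subseteq> verts G" using B G by (fastforce simp: nb_def simple_graph_def)
    then have "finite B" using G finite_subset by (auto simp: simple_graph_def)
    then obtain g where g: "bij_betw g {4..t} B"
      using finite_same_card_bij[of "{4..t}" B] cardB t by auto
    \<comment> \<open>The bristles of the broom sit at the vertex \<open>3\<close>, so
      \<open>0, 1, 2, 3\<close> must go to \<open>w, b, a, u\<close>, the handle read
      backwards.\<close>
    define f where "f i = (if i = 0 then w else if i = 1 then b else if i = 2 then a
      else if i = 3 then u else g i)" for i :: nat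
    have f: "f 0 = w" "f 1 = b" "f (Suc 0) = b" "f 2 = a" "f 3 = u" "\<And>i. i \<ge> 4 \<Longrightarrow> f i = g i"
      by (auto simp: f_def)
    have atMost: "{0..t} = {0, 1, 2, 3} \<union> {4..t}" using t by auto
    have img: "f ` {4..t} = B" using g f(6) by (auto simp: bij_betw_def image_def)
    have fV: "f ` {0..t} = {w, b, a, u} \<union> B" unfolding atMost image_Un img by (simp add: f)
    have "inj_on f {4..t}" using g f(6) by (auto simp: bij_betw_def inj_on_def)
    moreover have "inj_on f {0, 1, 2, 3}" using ne ne2 by (auto simp: inj_on_def f)
    moreover have "f ` {0, 1, 2, 3} \<inter> f ` {4..t} = {}"
      unfolding img using ne2(4) B by (auto simp: f)
    ultimately have inj: "inj_on f {0..t}"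
      unfolding atMost by (intro inj_on_UnI)
    let ?F = "{{b, w}, {a, b}, {u, a}} \<union> (\<lambda>x. {u, x}) ` B"
    define H where "H = \<lparr>verts = f ` {0..t}, edges = ?F\<rparr>"
    have FE: "?F \<subseteq> edges G" using e B by (auto simp: nb_def)
    have "subgraph H G"
      using FE e G \<open>B \<subseteq> verts G\<close> ne ne2 unfolding subgraph_def simple_graph_def H_def fV
      by (auto simp: fV finite_subset \<open>finite B\<close>)
    moreover have "isomorphic (broom t 3) H"
      unfolding isomorphic_def
    proof (intro exI conjI)
      show "bij_betw f (verts (broom t 3)) (verts H)"
        using inj by (auto simp: bij_betw_def H_def broom_def)
      have "(\<lambda>j. f ` {3, j}) ` {4..t} = (\<lambda>x. {u, x}) ` f ` {4..t}"
        by (simp add: image_image f)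
      then have "(\<lambda>j. f ` {3, j}) ` {4..t} = (\<lambda>x. {u, x}) ` B"
        by (simp only: img)
      then have "(\<lambda>e. f ` e) ` edges (broom t 3) = {{w, b}, {b, a}, {a, u}} \<union> (\<lambda>x. {u, x}) ` B"
        unfolding edges_broom3[OF t] image_Un image_image[of _ _ "{4..t}"]
        by (simp only: image_insert image_empty f)
      moreover have "{w, b} = {b, w}" "{b, a} = {a, b}" "{a, u} = {u, a}" by auto
      ultimately show "edges H = (\<lambda>e. f ` e) ` edges (broom t 3)"
        by (simp only: H_def graph.simps)
    qed
    moreover have "rainbow c H"
    proof -
      have "inj_on c ((\<lambda>x. {u, x}) ` B)"
        using B proper[of u] by (auto simp: inj_on_def nb_def)
      moreover have "c {a, b} \<noteq> c {b, w}" "c {u, a} \<noteq> c {a, b}"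
        using proper[of b a w] proper[of a u b] e ne by (simp_all add: insert_commute)
      then have "inj_on c {{b, w}, {a, b}, {u, a}}"
        using col by (auto simp: inj_on_def)
      \<comment> \<open>Properness at \<open>u\<close> separates a bristle from
        \<open>{u, a}\<close>; \<open>colB\<close> covers the other two handle edges.\<close>
      moreover have "c e \<noteq> c {u, x}" if "x \<in> B" "e \<in> {{b, w}, {a, b}, {u, a}}" for x e
      proof -
        have "c {u, a} \<noteq> c {u, x}" using that(1) B e proper[of u a x] by (auto simp: nb_def)
        moreover have "c {u, x} \<noteq> c {a, b}" "c {u, x} \<noteq> c {b, w}" using colB that(1) by auto
        ultimately show ?thesis using that(2) by auto
      qed
      then have "c ` {{b, w}, {a, b}, {u, a}} \<inter> c ` (\<lambda>x. {u, x}) ` B = {}"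
        by blast
      ultimately have "inj_on c ?F"
        by (intro inj_on_UnI)
      then show ?thesis by (simp add: rainbow_def H_def)
    qed
    ultimately show False using free by blast
  qed
qed

section \<open>Disjoint complete graphs\<close>

text \<open>The quotient by \<open>t + 1\<close> names the block of a vertex, and every full block
  is a complete graph; the last \<open>n mod (t + 1)\<close> vertices stay isolated.\<close>

definition cliques :: "nat \<Rightarrow> nat \<Rightarrow> nat graph" where
  "cliques t n = \<lparr>verts = {..<n},
     edges = {{x, y} |x y. x \<noteq> y \<and> x div (t + 1) = y div (t + 1) \<and>
       x < n div (t + 1) * (t + 1) \<and> y < n div (t + 1) * (t + 1)}\<rparr>"

text \<open>The standard 1-factorisation of \<open>K\<^bsub>t+1\<^esub>\<close> for odd \<open>t\<close>: residues \<open>i, j < t\<close> get the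
  colour \<open>i + j\<close> modulo \<open>t\<close>, and \<open>i\<close> is joined to the extra vertex \<open>t\<close> in the colour \<open>2 i\<close>.\<close>

definition clique_col :: "nat \<Rightarrow> nat set \<Rightarrow> nat" where
  "clique_col t e = (let s = (\<Sum>x\<in>e. x mod (t + 1)) in
     if \<exists>x\<in>e. x mod (t + 1) = t then 2 * s mod t else s mod t)"

lemma cliques_edge_iff:
  "{x, y} \<in> edges (cliques t n) \<longleftrightarrow> x \<noteq> y \<and> x div (t + 1) = y div (t + 1) \<and>
    x < n div (t + 1) * (t + 1) \<and> y < n div (t + 1) * (t + 1)"
  by (auto simp: cliques_def doubleton_eq_iff)

lemma simple_graph_cliques: "simple_graph (cliques t n)"
proof -
  have "n div (t + 1) * (t + 1) \<le> n" by (rule div_times_less_eq_dividend)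
  then show ?thesis
    by (auto simp: simple_graph_def cliques_def)
qed

text \<open>Each vertex of a full block is joined to the \<open>t\<close> others in it;
  \<open>sum_card_nb\<close> does the rest.\<close>

lemma card_cliques:
  "2 * card (edges (cliques t n)) = t * (n div (t + 1) * (t + 1))"
proof -
  let ?m = "t + 1"
  let ?W = "{..<n div ?m * ?m}" and ?E = "edges (cliques t n)"
  have fin: "finite ?E"
    using simple_graph_cliques[of t n] finite_subset[of ?E "Pow (verts (cliques t n))"]
    by (auto simp: simple_graph_def)
  have "card (nb ?E x) = t" if x: "x \<in> ?W" for x
  proof -
    have "nb ?E x = {x div ?m * ?m ..< x div ?m * ?m + ?m} - {x}"
    proof (intro set_eqI iffI)
      fix y assume "y \<in> nb ?E x"
      then have xy: "x \<noteq> y" "y div ?m = x div ?m" by (auto simp: nb_def cliques_edge_iff)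
      have "y div ?m * ?m + y mod ?m = y" "y mod ?m < ?m" by (simp_all only: div_mult_mod_eq) simp
      then have "x div ?m * ?m \<le> y" "y < x div ?m * ?m + ?m" unfolding xy(2) by linarith+
      with xy(1) show "y \<in> {x div ?m * ?m ..< x div ?m * ?m + ?m} - {x}" by simp
    next
      fix y assume y: "y \<in> {x div ?m * ?m ..< x div ?m * ?m + ?m} - {x}"
      then have "y div ?m = x div ?m"
        by (intro div_nat_eqI) (auto simp: algebra_simps)
      moreover have "y < n div ?m * ?m"
      proof -
        have "x div ?m < n div ?m" using x by (simp only: less_mult_imp_div_less lessThan_iff)
        then have "y div ?m < n div ?m" using calculation by simp
        then show ?thesis using div_less_iff_less_mult[of ?m y "n div ?m"] by linarith
      qed
      ultimately show "y \<in> nb ?E x"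
        using x y by (simp add: nb_def cliques_edge_iff)
    qed
    moreover have "x \<in> {x div ?m * ?m ..< x div ?m * ?m + ?m}"
    proof -
      have "x div ?m * ?m + x mod ?m = x" "x mod ?m < ?m" by (simp_all only: div_mult_mod_eq) simp
      then have "x div ?m * ?m \<le> x" "x < x div ?m * ?m + ?m" by linarith+
      then show ?thesis by simp
    qed
    ultimately show ?thesis by simp
  qed
  then have "(\<Sum>x\<in>?W. card (nb ?E x)) = t * (n div ?m * ?m)" by simp
  moreover have "(\<Sum>x\<in>?W. card (nb ?E x)) = 2 * card {e \<in> ?E. e \<inter> ?W \<noteq> {}}"
    by (rule sum_card_nb) (use fin in \<open>auto simp: cliques_def\<close>)
  moreover have "{e \<in> ?E. e \<inter> ?W \<noteq> {}} = ?E" by (auto simp: cliques_def)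
  ultimately show ?thesis by simp
qed

lemma clique_col_less: "0 < t \<Longrightarrow> clique_col t e < t"
  by (simp add: clique_col_def Let_def)

text \<open>A factor coprime to \<open>t\<close> cancels modulo \<open>t\<close>. The uses are
  \<open>q = 2\<close>, which is where odd \<open>t\<close> matters, and
  \<open>q = 1\<close>.\<close>

lemma mult_mod_inj:
  fixes t :: nat
  assumes "coprime q t" "(i + q * j) mod t = (i + q * k) mod t" "j < t" "k < t"
  shows "j = k"
  using assms(2-4)
proof (induction j k rule: linorder_wlog)
  case (le j k)
  then have "q * j \<le> q * k" by simp
  then have "t dvd (i + q * k) - (i + q * j)"
    using le(2) mod_eq_dvd_iff_nat[of "i + q * j" "i + q * k" t] by simp
  then have "t dvd q * (k - j)" by (simp add: diff_mult_distrib2)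
  then have "t dvd k - j"
    using assms(1) by (simp add: coprime_commute coprime_dvd_mult_right_iff)
  then show ?case using le by (cases "j = k") (auto dest: dvd_imp_le)
qed simp

lemma clique_col_proper:
  assumes t: "odd t" and e: "{x, y} \<in> edges (cliques t n)" "{x, z} \<in> edges (cliques t n)"
    and yz: "y \<noteq> z"
  shows "clique_col t {x, y} \<noteq> clique_col t {x, z}"
proof
  assume eq: "clique_col t {x, y} = clique_col t {x, z}"
  define r where "r u = u mod (t + 1)" for u
  have col: "clique_col t {x, y} = (if r x = t then (2 * r y) mod t else if r y = t
      then (2 * r x) mod t else (r x + r y) mod t)" if "x \<noteq> y" for x y
  proof -
    have "clique_col t {x, y} = (if r x = t \<or> r y = t then 2 * (r x + r y) mod t
        else (r x + r y) mod t)"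
      unfolding clique_col_def Let_def r_def[symmetric] using that by simp
    moreover have "2 * (t + q) mod t = 2 * q mod t" for q
      by (metis distrib_left mult.commute mod_mult_self4)
    ultimately show ?thesis by (auto simp: add.commute[of _ t])
  qed
  have inj: "p = q" if "p div (t + 1) = q div (t + 1)" "r p = r q" for p q
    using that unfolding r_def by (metis div_mult_mod_eq)
  have xy: "x \<noteq> y" "x \<noteq> z" using e unfolding cliques_edge_iff by blast+
  have "x div (t + 1) = y div (t + 1)" "x div (t + 1) = z div (t + 1)"
    using e unfolding cliques_edge_iff by blast+
  then have ne: "r x \<noteq> r y" "r x \<noteq> r z" "r y \<noteq> r z"
    using inj[of x y] inj[of x z] inj[of y z] xy yz by auto
  have lt: "r u < t" if "r u \<noteq> t" for u
    using that mod_less_divisor[of "t + 1" u] unfolding r_def by linarith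
  note eq' = eq[unfolded col[OF xy(1)] col[OF xy(2)]]
  consider "r x = t" | "r x \<noteq> t" "r y = t" | "r x \<noteq> t" "r z = t" | "r x \<noteq> t" "r y \<noteq> t" "r z \<noteq> t"
    by blast
  then show False
  proof cases
    case 1
    then have "2 * r y mod t = 2 * r z mod t" using eq' by simp
    then show False using mult_mod_inj[of 2 t 0 "r y" "r z"] t lt ne 1 by simp
  next
    case 2
    then have "(r x + r x) mod t = (r x + r z) mod t" using eq' ne by (simp add: mult_2)
    then show False using mult_mod_inj[of 1 t "r x" "r x" "r z"] lt ne 2 by simp
  next
    case 3
    then have "(r x + r y) mod t = (r x + r x) mod t" using eq' ne by (simp add: mult_2)
    then show False using mult_mod_inj[of 1 t "r x" "r y" "r x"] lt ne 3 by simp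
  next
    case 4
    then have "(r x + r y) mod t = (r x + r z) mod t" using eq' by simp
    then show False using mult_mod_inj[of 1 t "r x" "r y" "r z"] lt ne 4 by simp
  qed
qed

lemma cliques_no_rainbow_broom:
  assumes t: "t \<ge> 3" "odd t" and H: "subgraph H (cliques t n)" "isomorphic (broom t 3) H"
  shows "\<not> rainbow (clique_col t) H"
proof
  assume rb: "rainbow (clique_col t) H"
  let ?c = "clique_col t" and ?E = "edges (cliques t n)"
  obtain f where f: "bij_betw f {0..t} (verts H)" "edges H = (\<lambda>e. f ` e) ` edges (broom t 3)"
    using H(2) by (auto simp: isomorphic_def broom_def)
  have inj: "inj_on f {0..t}" using f(1) by (simp add: bij_betw_def)
  have HE: "{f i, f j} \<in> edges H" if "{i, j} \<in> edges (broom t 3)" for i j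
  proof -
    have "f ` {i, j} \<in> edges H" unfolding f(2) using that by (rule imageI)
    then show ?thesis by simp
  qed
  have hs: "{f 0, f 1} \<in> edges H" "{f 1, f 2} \<in> edges H" "{f 3, f 2} \<in> edges H"
  proof -
    show "{f 0, f 1} \<in> edges H" "{f 1, f 2} \<in> edges H"
      by (rule HE, simp add: edges_broom3[OF t(1)])+
    have "{f 2, f 3} \<in> edges H" by (rule HE) (simp add: edges_broom3[OF t(1)])
    then show "{f 3, f 2} \<in> edges H" by (simp add: insert_commute)
  qed
  have bs: "{f 3, f j} \<in> edges H" if "4 \<le> j" "j \<le> t" for j
    by (rule HE) (use that in \<open>simp add: edges_broom3[OF t(1)]\<close>)
  have EE: "edges H \<subseteq> ?E" using H(1) by (simp add: subgraph_def)
  have d: "f 0 div (t + 1) = f 3 div (t + 1)" "f 1 div (t + 1) = f 3 div (t + 1)"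
    and l: "f 0 < n div (t + 1) * (t + 1)" "f 1 < n div (t + 1) * (t + 1)"
      "f 3 < n div (t + 1) * (t + 1)"
    using subsetD[OF EE hs(1)] subsetD[OF EE hs(2)] subsetD[OF EE hs(3)]
    unfolding cliques_edge_iff by simp_all
  have f_eq: "f i = f j \<longleftrightarrow> i = j" if "i \<le> t" "j \<le> t" for i j
    using inj that by (auto simp: inj_on_def)
  \<comment> \<open>All broom vertices lie in one block, so the centre \<open>f 3\<close> is joined
    in the clique even to \<open>f 0\<close> and \<open>f 1\<close>, its non-neighbours in the
    broom.\<close>
  have star: "{f 3, f j} \<in> ?E" if jt: "j \<in> {0..t} - {3}" for j
  proof -
    consider "j = 0" | "j = 1" | "j = 2" | "4 \<le> j" using jt by force
    then show ?thesis
    proof cases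
      case 1 then show ?thesis using d l f_eq[of 3 0] t(1) by (simp only: cliques_edge_iff) simp
    next
      case 2 then show ?thesis using d l f_eq[of 3 1] t(1) by (simp only: cliques_edge_iff) simp
    qed (use hs bs jt EE in auto)
  qed
  \<comment> \<open>The \<open>t\<close> clique edges at the centre have distinct colours below
    \<open>t\<close>, so every colour occurs there, including that of
    \<open>{f 0, f 1}\<close>.\<close>
  have "inj_on (\<lambda>j. ?c {f 3, f j}) ({0..t} - {3})"
  proof (rule inj_onI, rule ccontr)
    fix i j assume ij: "i \<in> {0..t} - {3}" "j \<in> {0..t} - {3}"
      "?c {f 3, f i} = ?c {f 3, f j}" "i \<noteq> j"
    then have "f i \<noteq> f j" using f_eq[of i j] by auto
    with ij show False using clique_col_proper[OF t(2) star star] by blast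
  qed
  then have "card ((\<lambda>j. ?c {f 3, f j}) ` ({0..t} - {3})) = t"
    using t(1) by (simp add: card_image)
  moreover have "(\<lambda>j. ?c {f 3, f j}) ` ({0..t} - {3}) \<subseteq> {..<t}"
    using clique_col_less t(1) by auto
  ultimately have "(\<lambda>j. ?c {f 3, f j}) ` ({0..t} - {3}) = {..<t}"
    by (intro card_subset_eq) auto
  then have "?c {f 0, f 1} \<in> (\<lambda>j. ?c {f 3, f j}) ` ({0..t} - {3})"
    using clique_col_less[of t] t(1) by simp
  then obtain j where j: "j \<in> {0..t} - {3}" "?c {f 0, f 1} = ?c {f 3, f j}" by blast
  have E01: "{f 0, f 1} \<in> ?E" using hs EE by auto
  have ne: "f 3 \<noteq> f 0" "f 3 \<noteq> f 1" using f_eq[of 3 0] f_eq[of 3 1] t(1) by auto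
  \<comment> \<open>For \<open>j = 0\<close> or \<open>j = 1\<close> the two equally coloured edges
    share an end; otherwise both belong to the rainbow broom.\<close>
  consider "j = 0" | "j = 1" | "j = 2 \<or> 4 \<le> j" using j(1) by force
  then show False
  proof cases
    case 1
    have "?c {f 0, f 1} \<noteq> ?c {f 0, f 3}"
      by (rule clique_col_proper[OF t(2)]) (use E01 star[OF j(1)] 1 ne in \<open>auto simp: insert_commute\<close>)
    then show False using j 1 by (simp add: insert_commute)
  next
    case 2
    have "?c {f 1, f 0} \<noteq> ?c {f 1, f 3}"
      by (rule clique_col_proper[OF t(2)]) (use E01 star[OF j(1)] 2 ne in \<open>auto simp: insert_commute\<close>)
    then show False using j 2 by (simp add: insert_commute)
  next
    case 3
    then have "{f 3, f j} \<in> edges H" using hs bs j by auto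
    then have "{f 0, f 1} = {f 3, f j}"
      using rb hs(1) j(2) by (auto simp: rainbow_def inj_on_def)
    then show False using ne by (auto simp: doubleton_eq_iff)
  qed
qed

lemma rainbow_free_cliques:
  assumes "t \<ge> 3" "odd t"
  shows "rainbow_free (broom t 3) (cliques t n)"
  unfolding rainbow_free_def
proof (intro exI conjI)
  show "proper_edge_coloring (cliques t n) (clique_col t)"
    unfolding proper_edge_coloring_def
  proof (intro ballI impI)
    fix e e' assume e: "e \<in> edges (cliques t n)" "e' \<in> edges (cliques t n)" "e \<noteq> e' \<and> e \<inter> e' \<noteq> {}"
    have "card e = 2" "card e' = 2"
      using e simple_graph_cliques[of t n] by (auto simp: simple_graph_def)
    moreover obtain x where "x \<in> e" "x \<in> e'" using e by auto
    ultimately obtain y z where "e = {x, y}" "e' = {x, z}" by (auto simp: card_2_iff)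
    with e show "clique_col t e \<noteq> clique_col t e'"
      using clique_col_proper[OF assms(2), of x y n z] by auto
  qed
  show "\<not> (\<exists>H. subgraph H (cliques t n) \<and> isomorphic (broom t 3) H \<and> rainbow (clique_col t) H)"
    using cliques_no_rainbow_broom[OF assms] by blast
qed

theorem theorem1p4:
  fixes t :: nat
  assumes "t \<ge> 3" and "odd t"
  shows "(\<lambda>n. real (rainbow_turan n (broom t 3)) - real t / 2 * real n) \<in> O(\<lambda>_. 1)"
\<comment> \<open>Only the lower bound has an error: at most \<open>t\<close> vertices lie outside
  full blocks, and each costs \<open>t / 2\<close>. The estimate holds for every
  \<open>n\<close>.\<close>
proof (rule bigoI[where c = "real (t * t) / 2"], rule always_eventually, rule allI)
  fix n
  let ?S = "rainbow_turan_set n (broom t 3)"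
  have "edges (broom t 3) \<noteq> {}" using assms(1) by (simp add: edges_broom3)
  then have ne: "?S \<noteq> {}" by (rule rainbow_turan_set_nonempty)
  have "rainbow_turan n (broom t 3) \<in> ?S"
    unfolding rainbow_turan_def by (rule Max_in[OF finite_rainbow_turan_set ne])
  then obtain G :: "nat graph" where G: "rainbow_turan n (broom t 3) = card (edges G)"
    "simple_graph G" "card (verts G) = n" "rainbow_free (broom t 3) G"
    by (auto simp: rainbow_turan_set_def)
  then obtain c where "broom_free_graph (verts G) (edges G) c t"
    using broom_free_graph_of_coloring[OF assms(1)] unfolding rainbow_free_def by blast
  then have "2 * card (edges G) \<le> t * card (verts G)"
    by (rule card_edges_le[OF _ assms])
  then have "2 * rainbow_turan n (broom t 3) \<le> t * n" using G by simp
  then have upper: "2 * real (rainbow_turan n (broom t 3)) \<le> real t * real n"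
    by (metis of_nat_le_iff of_nat_mult of_nat_numeral)
  have "card (edges (cliques t n)) \<in> ?S"
    unfolding rainbow_turan_set_def
    using simple_graph_cliques rainbow_free_cliques[OF assms]
    by (intro CollectI exI[of _ "cliques t n"]) (simp add: cliques_def)
  then have "card (edges (cliques t n)) \<le> rainbow_turan n (broom t 3)"
    unfolding rainbow_turan_def by (rule Max_ge[OF finite_rainbow_turan_set])
  then have "t * (n div (t + 1) * (t + 1)) \<le> 2 * rainbow_turan n (broom t 3)"
    using card_cliques[of t n] by linarith
  moreover have "n \<le> n div (t + 1) * (t + 1) + t"
    using div_mult_mod_eq[of n "t + 1"] mod_less_divisor[of "t + 1" n] by linarith
  then have "t * n \<le> t * (n div (t + 1) * (t + 1)) + t * t"
    by (metis distrib_left mult_le_mono2)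
  ultimately have "t * n \<le> 2 * rainbow_turan n (broom t 3) + t * t" by linarith
  then have "real t * real n \<le> 2 * real (rainbow_turan n (broom t 3)) + real (t * t)"
    by (metis of_nat_add of_nat_le_iff of_nat_mult of_nat_numeral)
  with upper show "norm (real (rainbow_turan n (broom t 3)) - real t / 2 * real n)
      \<le> real (t * t) / 2 * norm (1 :: real)"
    by (simp add: abs_le_iff)
qed

end
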